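(* Consider a refracting piecewise-$C^k$ system ($k \ge 1$) $\dot{x} = f^L(x)$ for $H(x)<0$, $\dot{x} = f^R(x)$ for $H(x)>0$, on an open set $\Omega \subset \mathbb{R}^n$, with tangency surface $\mathcal{T}$, and let $\eta(x) = (H(x), V(x))$, where $V = \mathcal{L}_{f^L} H$. Then $f^{\rm tan}(x) = f^T(x)$ at any $x \in \mathcal{T}$ belonging to a visible-visible or invisible-invisible region, where $f^{\rm tan}$ is the tangential sliding vector field associated with $\eta$ and $f^T$ is the second-order sliding vector field.
   Context: Let $\Omega \subset \mathbb{R}^n$ be open. The system $\dot{x} = f^L(x)$ if $H(x)<0$, $\dot{x}=f^R(x)$ if $H(x)>0$ is piecewise-$C^k$ if $f^L, f^R : \Omega \to \mathbb{R}^n$ are $C^k$ and $H : \Omega \to \mathbb{R}$ is $C^{k+1}$ with $\nabla H(x) \ne 0$ for all $x \in \Sigma$, where $\Sigma = \{ x \in \Omega : H(x) = 0 \}$. Lie derivatives: $\mathcal{L}_f^0 h = h$ and $\mathcal{L}_f^m h(x) = (\nabla \mathcal{L}_f^{m-1} h(x))^{\sf T} f(x)$ for $m \ge 1$; $\mathcal{L}_f h = \mathcal{L}_f^1 h$. (For $h=H$ these can equivalently be defined as $\mathcal{L}_f^m H(x) = \frac{\partial^m}{\partial t^m} H(\varphi_t(x))|_{t=0}$, with $\varphi_t$ the flow of $f$.) The system is refracting if $\mathcal{L}_{f^L} H(x) = \mathcal{L}_{f^R} H(x)$ for all $x \in \Sigma$. Write $V(x) = \mathcal{L}_{f^L} H(x)$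 for $x \in \Omega$. The tangency surface is $\mathcal{T} = \{ x \in \Sigma : V(x) = 0 \}$. A subset $S \subset \mathcal{T}$ is a visible-visible region if $\mathcal{L}_{f^L}^2 H < 0$ and $\mathcal{L}_{f^R}^2 H > 0$ on $S$, and an invisible-invisible region if $\mathcal{L}_{f^L}^2 H > 0$ and $\mathcal{L}_{f^R}^2 H < 0$ on $S$. The second-order sliding vector field, defined at $x \in \mathcal{T}$ with $\mathcal{L}_{f^L}^2 H(x) \ne \mathcal{L}_{f^R}^2 H(x)$, is $$f^T(x) = \frac{f^R(x) \mathcal{L}_{f^L}^2 H(x) - f^L(x) \mathcal{L}_{f^R}^2 H(x)}{\mathcal{L}_{f^L}^2 H(x) - \mathcal{L}_{f^R}^2 H(x)}.$$ The tangential sliding vector field of Carvalho et al. on the surface $\{x : \eta(x) = 0\}$ (here equal to $\mathcal{T}$) is $$f^{\rm tan}(x) = \frac{1-\lambda^*(x)}{2} f^R(x) + \frac{1+\lambda^*(x)}{2} f^L(x), \qquad \lambda^*(x) = \frac{\| d\eta(x) f^R(x) \| - \| d\eta(x) f^L(x) \|}{\| d\eta(x) f^R(x) \| + \| d\eta(x) f^L(x) \|},$$ where $d\eta(x)$ is the Jacobian matrix of $\eta$ at $x$ and $\|\cdot\|$ is the Euclidean norm. *)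

theory Defs
  imports "HOL-Analysis.Analysis"
begin

(* Only meant for open S, where the unrestricted derivative "at x" is the derivative on S.
   All fields below are total functions; their values outside \<Omega> are irrelevant. *)
fun C_k_on :: "nat \<Rightarrow> ('a::euclidean_space \<Rightarrow> 'b::real_normed_vector) \<Rightarrow> 'a set \<Rightarrow> bool" where
  "C_k_on 0 f S \<longleftrightarrow> continuous_on S f"
| "C_k_on (Suc k) f S \<longleftrightarrow>
     (\<forall>x\<in>S. f differentiable (at x)) \<and>
     (\<forall>v. C_k_on k (\<lambda>x. frechet_derivative f (at x) v) S)"

(* Unspecified at points where h is not differentiable. *)
definition gradient :: "(real^'n \<Rightarrow> real) \<Rightarrow> real^'n \<Rightarrow> real^'n" where
  "gradient h x = (THE D. GDERIV h x :> D)"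

fun lie_derivative :: "(real^'n \<Rightarrow> real^'n) \<Rightarrow> nat \<Rightarrow> (real^'n \<Rightarrow> real) \<Rightarrow> real^'n \<Rightarrow> real" where
  "lie_derivative f 0 h = h"
| "lie_derivative f (Suc m) h = (\<lambda>x. gradient (lie_derivative f m h) x \<bullet> f x)"

definition switching_surface :: "(real^'n) set \<Rightarrow> (real^'n \<Rightarrow> real) \<Rightarrow> (real^'n) set" where
  "switching_surface \<Omega> H = {x \<in> \<Omega>. H x = 0}"

(* The system x' = fL x for H x < 0, x' = fR x for H x > 0 is given by its data \<Omega>, H, fL, fR. *)
definition piecewise_C_k ::
  "nat \<Rightarrow> (real^'n) set \<Rightarrow> (real^'n \<Rightarrow> real) \<Rightarrow> (real^'n \<Rightarrow> real^'n) \<Rightarrow> (real^'n \<Rightarrow> real^'n) \<Rightarrow> bool" where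
  "piecewise_C_k k \<Omega> H fL fR \<longleftrightarrow>
     open \<Omega> \<and> C_k_on k fL \<Omega> \<and> C_k_on k fR \<Omega> \<and> C_k_on (k + 1) H \<Omega> \<and>
     (\<forall>x\<in>switching_surface \<Omega> H. gradient H x \<noteq> 0)"

definition refracting ::
  "(real^'n) set \<Rightarrow> (real^'n \<Rightarrow> real) \<Rightarrow> (real^'n \<Rightarrow> real^'n) \<Rightarrow> (real^'n \<Rightarrow> real^'n) \<Rightarrow> bool" where
  "refracting \<Omega> H fL fR \<longleftrightarrow>
     (\<forall>x\<in>switching_surface \<Omega> H. lie_derivative fL 1 H x = lie_derivative fR 1 H x)"

definition tangency_surface ::
  "(real^'n) set \<Rightarrow> (real^'n \<Rightarrow> real) \<Rightarrow> (real^'n \<Rightarrow> real^'n) \<Rightarrow> (real^'n) set" where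
  "tangency_surface \<Omega> H fL = {x \<in> switching_surface \<Omega> H. lie_derivative fL 1 H x = 0}"

definition visible_visible_region ::
  "(real^'n) set \<Rightarrow> (real^'n \<Rightarrow> real) \<Rightarrow> (real^'n \<Rightarrow> real^'n) \<Rightarrow> (real^'n \<Rightarrow> real^'n) \<Rightarrow> (real^'n) set \<Rightarrow> bool" where
  "visible_visible_region \<Omega> H fL fR S \<longleftrightarrow>
     S \<subseteq> tangency_surface \<Omega> H fL \<and>
     (\<forall>x\<in>S. lie_derivative fL 2 H x < 0 \<and> lie_derivative fR 2 H x > 0)"

definition invisible_invisible_region ::
  "(real^'n) set \<Rightarrow> (real^'n \<Rightarrow> real) \<Rightarrow> (real^'n \<Rightarrow> real^'n) \<Rightarrow> (real^'n \<Rightarrow> real^'n) \<Rightarrow> (real^'n) set \<Rightarrow> bool" where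
  "invisible_invisible_region \<Omega> H fL fR S \<longleftrightarrow>
     S \<subseteq> tangency_surface \<Omega> H fL \<and>
     (\<forall>x\<in>S. lie_derivative fL 2 H x > 0 \<and> lie_derivative fR 2 H x < 0)"

(* Meaningful only where the two second Lie derivatives of H differ. *)
definition second_order_sliding ::
  "(real^'n \<Rightarrow> real) \<Rightarrow> (real^'n \<Rightarrow> real^'n) \<Rightarrow> (real^'n \<Rightarrow> real^'n) \<Rightarrow> real^'n \<Rightarrow> real^'n" where
  "second_order_sliding H fL fR x =
     (lie_derivative fL 2 H x *\<^sub>R fR x - lie_derivative fR 2 H x *\<^sub>R fL x)
       /\<^sub>R (lie_derivative fL 2 H x - lie_derivative fR 2 H x)"

definition sliding_weight ::
  "(real^'n \<Rightarrow> real^'m) \<Rightarrow> (real^'n \<Rightarrow> real^'n) \<Rightarrow> (real^'n \<Rightarrow> real^'n) \<Rightarrow> real^'n \<Rightarrow> real" where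
  "sliding_weight \<eta> fL fR x =
     (norm (jacobian \<eta> (at x) *v fR x) - norm (jacobian \<eta> (at x) *v fL x)) /
     (norm (jacobian \<eta> (at x) *v fR x) + norm (jacobian \<eta> (at x) *v fL x))"

(* Meaningful only where the denominator of sliding_weight is nonzero. *)
definition tangential_sliding ::
  "(real^'n \<Rightarrow> real^'m) \<Rightarrow> (real^'n \<Rightarrow> real^'n) \<Rightarrow> (real^'n \<Rightarrow> real^'n) \<Rightarrow> real^'n \<Rightarrow> real^'n" where
  "tangential_sliding \<eta> fL fR x =
     ((1 - sliding_weight \<eta> fL fR x) / 2) *\<^sub>R fR x +
     ((1 + sliding_weight \<eta> fL fR x) / 2) *\<^sub>R fL x"

end

theory Submission
  imports Defs
begin

text \<open>
  Both \<open>V\<close> and the first Lie derivative \<open>W\<close> of \<open>H\<close> along \<open>fR\<close> are differentiable and agree on the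
  surface \<open>H = 0\<close>, so their differentials agree on vectors tangent to that surface. At a tangency
  point \<open>fR\<close> is such a vector, so \<open>dV fR = dW fR\<close> is the second Lie derivative of \<open>H\<close> along \<open>fR\<close>.
  Thus \<open>d\<eta> fL\<close> and \<open>d\<eta> fR\<close> are \<open>(0, a)\<close> and \<open>(0, b)\<close> with \<open>a\<close>, \<open>b\<close> the two second Lie derivatives,
  and since these have opposite signs, the norms in the sliding weight are \<open>\<bar>a\<bar>\<close> and \<open>\<bar>b\<bar>\<close>
  with \<open>\<bar>a\<bar> + \<bar>b\<bar> = \<bar>a - b\<bar>\<close>.
\<close>

text \<open>Along the line \<open>x + t v + c t u\<close> the derivative of \<open>h\<close> at
  \<open>t = 0\<close> is \<open>c\<close> times \<open>h' u\<close>, because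
  \<open>h' v = 0\<close>. Taking \<open>c = e\<close> and \<open>c = - e\<close> gives opposite
  signs of \<open>h\<close> for small \<open>t > 0\<close>, and the intermediate value theorem in
  \<open>s\<close> yields a zero in between. This stands in for the implicit function theorem: zeros
  of \<open>h\<close> are found within \<open>e t\<close> of the tangent ray.\<close>

lemma tangent_direction_meets_zero_set:
  fixes h :: "'a::real_normed_vector \<Rightarrow> real"
  assumes S: "open S" "x \<in> S" and cont: "continuous_on S h"
    and h: "(h has_derivative h') (at x)" "h x = 0" "h' v = 0" "h' u > 0" and e: "e > 0"
  shows "\<exists>d>0. \<forall>t. 0 < t \<and> t < d \<longrightarrow>
           (\<exists>s. \<bar>s\<bar> \<le> e * t \<and> x + t *\<^sub>R v + s *\<^sub>R u \<in> S \<and> h (x + t *\<^sub>R v + s *\<^sub>R u) = 0)"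
proof -
  have lin: "linear h'" using h(1) has_derivative_linear by blast
  have der: "((\<lambda>t. h (x + t *\<^sub>R v + (c * t) *\<^sub>R u)) has_real_derivative c * h' u) (at 0)" for c
  proof -
    have h0: "(h has_derivative h') (at (x + 0 *\<^sub>R v + (c * 0) *\<^sub>R u))"
      using h(1) by simp
    have "((\<lambda>t. x + t *\<^sub>R v + (c * t) *\<^sub>R u) has_derivative (\<lambda>t. t *\<^sub>R v + (c * t) *\<^sub>R u)) (at 0)"
      by (auto intro!: derivative_eq_intros)
    from has_derivative_compose[OF this h0] show ?thesis
      by (rule has_derivative_imp_has_field_derivative)
        (simp add: linear_add[OF lin] linear_scale[OF lin] h(3))
  qed
  obtain d1 where d1: "d1 > 0"
    "\<And>t. 0 < t \<Longrightarrow> t < d1 \<Longrightarrow> 0 < h (x + t *\<^sub>R v + (e * t) *\<^sub>R u)"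
    using DERIV_pos_inc_right[OF der[of e]] h e by auto
  obtain d2 where d2: "d2 > 0"
    "\<And>t. 0 < t \<Longrightarrow> t < d2 \<Longrightarrow> h (x + t *\<^sub>R v + (- e * t) *\<^sub>R u) < 0"
    using DERIV_neg_dec_right[OF der[of "- e"]] h e by auto
  obtain r where r: "r > 0" "ball x r \<subseteq> S"
    using S open_contains_ball by metis
  \<comment> \<open>\<open>t M\<close> strictly exceeds every displacement with \<bar>s\<bar> \<le>
    \<open>e t\<close>, so \<open>t < r / M\<close> keeps the whole segment inside the ball; the
    summand 1 makes the bound strict and \<open>M\<close> positive.\<close>
  define M where "M = norm v + e * norm u + 1"
  have "M > 0" using e by (simp add: M_def add_nonneg_pos)
  have "\<exists>s. \<bar>s\<bar> \<le> e * t \<and> x + t *\<^sub>R v + s *\<^sub>R u \<in> S \<and> h (x + t *\<^sub>R v + s *\<^sub>R u) = 0"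
    if t: "0 < t" "t < min (r / M) (min d1 d2)" for t
  proof -
    have inS: "x + t *\<^sub>R v + s *\<^sub>R u \<in> S" if "\<bar>s\<bar> \<le> e * t" for s
    proof -
      have "norm (t *\<^sub>R v + s *\<^sub>R u) \<le> t * norm v + \<bar>s\<bar> * norm u"
        using norm_triangle_ineq[of "t *\<^sub>R v" "s *\<^sub>R u"] t by simp
      also have "\<dots> \<le> t * norm v + e * t * norm u"
        using that by (simp add: mult_right_mono)
      also have "\<dots> < t * M" using t by (simp add: M_def algebra_simps)
      also have "\<dots> < r" using t \<open>M > 0\<close> by (simp add: field_simps)
      finally have "x + (t *\<^sub>R v + s *\<^sub>R u) \<in> ball x r"
        by (simp only: mem_ball dist_norm norm_minus_commute[of x] add_diff_cancel_left')
      then show ?thesis using r(2) by (auto simp: add.assoc)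
    qed
    have "continuous_on {- e * t .. e * t} (\<lambda>s. h (x + t *\<^sub>R v + s *\<^sub>R u))"
      by (intro continuous_on_compose2[OF cont] continuous_intros) (auto intro!: inS)
    moreover have "h (x + t *\<^sub>R v + (- e * t) *\<^sub>R u) \<le> 0" "0 \<le> h (x + t *\<^sub>R v + (e * t) *\<^sub>R u)"
      using d1(2)[of t] d2(2)[of t] t by (simp_all add: less_imp_le)
    moreover have "- e * t \<le> e * t" using t e by simp
    ultimately obtain s where s: "- e * t \<le> s" "s \<le> e * t" "h (x + t *\<^sub>R v + s *\<^sub>R u) = 0"
      using IVT'[of "\<lambda>s. h (x + t *\<^sub>R v + s *\<^sub>R u)" "- e * t" 0 "e * t"] by blast
    then have "\<bar>s\<bar> \<le> e * t" by (simp add: abs_le_iff)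
    then show ?thesis using inS s(3) by blast
  qed
  moreover have "min (r / M) (min d1 d2) > 0" using r \<open>M > 0\<close> d1 d2 by simp
  ultimately show ?thesis by blast
qed

text \<open>Zeros of \<open>h\<close> approximate the ray in direction \<open>v\<close> to first
  order, and \<open>g\<close> vanishes at them. Hence \<open>g'\<close> of the displacement is small
  relative to its length, and dividing by \<open>t\<close> leaves only multiples of
  \<open>e\<close>, which is arbitrary.\<close>

lemma derivative_tangent_eq_0:
  fixes h :: "'a::real_normed_vector \<Rightarrow> real" and g :: "'a \<Rightarrow> 'b::real_normed_vector"
  assumes S: "open S" "x \<in> S" and cont: "continuous_on S h"
    and h: "(h has_derivative h') (at x)" "h x = 0" "h' v = 0" "h' u \<noteq> 0"
    and g: "(g has_derivative g') (at x)" and g0: "\<And>y. y \<in> S \<Longrightarrow> h y = 0 \<Longrightarrow> g y = 0"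
  shows "g' v = 0"
proof -
  have linh: "linear h'" and ling: "linear g'"
    using h(1) g has_derivative_linear by blast+
  \<comment> \<open>The sign of \<open>h' u\<close> is unknown; passing to \<open>- u\<close> if
    necessary makes the transversal derivative positive.\<close>
  obtain w where w: "h' w > 0"
  proof (cases "h' u > 0")
    case False
    then show ?thesis using that[of "- u"] h(4) linear_neg[OF linh, of u] by simp
  qed (use that in blast)
  \<comment> \<open>The term \<open>norm (g' w)\<close> pays for the correction \<open>s w\<close>,
    the other two for the linearisation error of \<open>g\<close>; none depends on
    \<open>e\<close>.\<close>
  define C where "C = norm (g' w) + norm v + norm w"
  have bound: "norm (g' v) \<le> e * C" if e: "0 < e" "e \<le> 1" for e
  proof -
    obtain d1 where d1: "d1 > 0" "\<And>t. 0 < t \<Longrightarrow> t < d1 \<Longrightarrow>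
        \<exists>s. \<bar>s\<bar> \<le> e * t \<and> x + t *\<^sub>R v + s *\<^sub>R w \<in> S \<and> h (x + t *\<^sub>R v + s *\<^sub>R w) = 0"
      using tangent_direction_meets_zero_set[OF S cont h(1-3) w e(1)] by blast
    obtain d2 where d2: "d2 > 0" "\<And>y. norm (y - x) < d2 \<Longrightarrow>
        norm (g y - g x - g' (y - x)) \<le> e * norm (y - x)"
      using g e(1) unfolding has_derivative_at_alt by blast
    define M where "M = norm v + norm w + 1"
    have "M > 0" by (simp add: M_def add_nonneg_pos)
    have "0 < d2 / M" using d2 \<open>M > 0\<close> by simp
    then obtain t where t: "0 < t" "t < d1" "t < d2 / M"
      using field_lbound_gt_zero[OF d1(1)] by blast
    obtain s where s: "\<bar>s\<bar> \<le> e * t" "x + t *\<^sub>R v + s *\<^sub>R w \<in> S" "h (x + t *\<^sub>R v + s *\<^sub>R w) = 0"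
      using d1(2)[OF t(1,2)] by blast
    define z where "z = t *\<^sub>R v + s *\<^sub>R w"
    \<comment> \<open>The restriction \<open>e\<close> \<le> 1 serves here: it bounds
      \<open>norm z / t\<close> independently of \<open>e\<close>.\<close>
    have "e * t \<le> t" using e t(1) by simp
    then have "\<bar>s\<bar> \<le> t" using s(1) by linarith
    then have "\<bar>s\<bar> * norm w \<le> t * norm w" by (rule mult_right_mono) simp
    then have nz: "norm z \<le> t * (norm v + norm w)"
      using norm_triangle_ineq[of "t *\<^sub>R v" "s *\<^sub>R w"] t(1)
      by (simp add: z_def algebra_simps)
    also have "\<dots> < t * M" using t(1) by (simp add: M_def algebra_simps)
    also have "\<dots> < d2" using t(3) \<open>M > 0\<close> by (simp add: field_simps)
    finally have "norm z < d2" .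
    moreover have "g (x + z) = 0" "g x = 0"
      using g0 s S h(2) by (simp_all add: z_def add.assoc)
    ultimately have gz: "norm (g' z) \<le> e * norm z"
      using d2(2)[of "x + z"] by simp
    have "t *\<^sub>R g' v = g' z - s *\<^sub>R g' w"
      by (simp add: z_def linear_add[OF ling] linear_scale[OF ling])
    then have "t * norm (g' v) \<le> norm (g' z) + \<bar>s\<bar> * norm (g' w)"
      using norm_triangle_ineq4[of "g' z" "s *\<^sub>R g' w"] t(1)
      by (metis abs_of_pos norm_scaleR)
    also have "\<dots> \<le> e * (t * (norm v + norm w)) + (e * t) * norm (g' w)"
      using gz nz e(1) s(1)
      by (intro add_mono mult_right_mono) (auto intro: order_trans mult_left_mono)
    also have "\<dots> = t * (e * C)" by (simp add: C_def algebra_simps)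
    finally show ?thesis using t(1) by simp
  qed
  have "((\<lambda>e. e * C) \<longlongrightarrow> 0 * C) (at_right 0)"
    by (intro tendsto_intros)
  moreover have "\<forall>\<^sub>F e in at_right (0::real). norm (g' v) \<le> e * C"
    unfolding eventually_at_right_field using bound by (intro exI[of _ 1]) auto
  ultimately have "norm (g' v) \<le> 0 * C"
    by (intro tendsto_lowerbound) auto
  then show ?thesis by simp
qed

text \<open>\<open>gradient\<close> is a definite description, so both existence and uniqueness have
  to be shown; the witness is the Riesz vector \<open>D\<close> built from the values of the
  derivative on \<open>Basis\<close>.\<close>

lemma gradient_inner:
  assumes "h differentiable (at x)"
  shows "gradient h x \<bullet> v = frechet_derivative h (at x) v"
proof -
  let ?f = "frechet_derivative h (at x)"
  have d: "(h has_derivative ?f) (at x)"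
    using assms frechet_derivative_works by blast
  define D where "D = (\<Sum>b\<in>Basis. ?f b *\<^sub>R b)"
  have eq: "?f w = w \<bullet> D" for w
    using Linear_Algebra.linear_componentwise[OF has_derivative_linear[OF d], of w 1]
    by (simp add: D_def inner_sum_right mult.commute)
  have D: "GDERIV h x :> D"
    using d unfolding gderiv_def ext[of ?f, OF eq] .
  moreover have "E = D" if "GDERIV h x :> E" for E
  proof -
    have "(\<lambda>w. w \<bullet> E) = (\<lambda>w. w \<bullet> D)"
      using that D unfolding gderiv_def by (rule has_derivative_unique)
    then have "\<forall>w. w \<bullet> E = w \<bullet> D" by (simp add: fun_eq_iff)
    then show ?thesis by (simp only: vector_eq_ldot)
  qed
  ultimately have "gradient h x = D"
    unfolding gradient_def by (rule the_equality)
  then show ?thesis by (simp add: eq inner_commute)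
qed

lemma lie_derivative_Suc_eq_frechet:
  assumes "lie_derivative f m h differentiable (at x)"
  shows "lie_derivative f (Suc m) h x = frechet_derivative (lie_derivative f m h) (at x) (f x)"
  using gradient_inner[OF assms] by simp

lemma C_k_on_imp_continuous_on:
  "C_k_on k f S \<Longrightarrow> continuous_on S f"
  by (cases k)
    (auto intro!: continuous_at_imp_continuous_on differentiable_imp_continuous_within)

text \<open>\<open>C_k_on\<close> controls derivatives of \<open>H\<close> in fixed directions only,
  whereas here the direction \<open>f y\<close> moves with \<open>y\<close>. Expanding
  \<open>f y\<close> in \<open>Basis\<close> gives a finite sum of products of differentiable
  functions.\<close>

lemma lie_derivative_1_differentiable:
  fixes H :: "real^'n \<Rightarrow> real"
  assumes "open \<Omega>" "x \<in> \<Omega>" and H: "C_k_on (Suc (Suc k)) H \<Omega>" and f: "f differentiable (at x)"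
  shows "lie_derivative f 1 H differentiable (at x)"
proof -
  let ?g = "\<lambda>y. \<Sum>b\<in>Basis. (f y \<bullet> b) * frechet_derivative H (at y) b"
  have eq: "?g y = lie_derivative f 1 H y" if "y \<in> \<Omega>" for y
  proof -
    have dH: "H differentiable (at y)" using H that by simp
    then have "linear (frechet_derivative H (at y))"
      using frechet_derivative_works has_derivative_linear by blast
    from Linear_Algebra.linear_componentwise[OF this, of "f y" 1] show ?thesis
      using gradient_inner[OF dH, of "f y"] by simp
  qed
  have "(\<lambda>y. frechet_derivative H (at y) b) differentiable (at x)" for b
    using H assms(2) by simp
  then have "?g differentiable (at x)"
    using f by (intro differentiable_sum differentiable_mult ballI) auto
  then show ?thesis
    unfolding differentiable_def
    using has_derivative_transform_within_open[OF _ assms(1,2), of ?g] eq by blast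
qed

lemma jacobian_vector_2:
  fixes a b :: "real^'n \<Rightarrow> real"
  assumes "(a has_derivative a') (at x)" "(b has_derivative b') (at x)"
  shows "jacobian (\<lambda>y. vector [a y, b y] :: real^2) (at x) *v w = vector [a' w, b' w]"
proof -
  let ?\<eta> = "\<lambda>y. vector [a y, b y] :: real^2"
  have "((\<lambda>y. ?\<eta> y \<bullet> axis i 1) has_derivative (\<lambda>w. vector [a' w, b' w] \<bullet> axis i 1)) (at x)" for i
    using assms exhaust_2[of i] by (auto simp: inner_axis)
  then have d: "(?\<eta> has_derivative (\<lambda>w. vector [a' w, b' w])) (at x)"
    by (subst has_derivative_componentwise_within) (auto simp: Basis_vec_def)
  then have "(?\<eta> has_derivative (*v) (jacobian ?\<eta> (at x))) (at x)"
    using jacobian_works differentiableI by blast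
  from fun_cong[OF has_derivative_unique[OF this d]] show ?thesis .
qed

lemma norm_vector_2: "norm (vector [0, a] :: real^2) = \<bar>a\<bar>"
  by (simp add: norm_vec_def L2_set_def sum_2)

text \<open>In both sign cases \<open>l = (a + b) / (b - a)\<close>, so the weights become
  \<open>a / (a - b)\<close> and \<open>- b / (a - b)\<close>.\<close>

lemma sliding_combination_eq:
  fixes a b :: real and p q :: "'a::real_vector"
  assumes "a < 0 \<and> b > 0 \<or> a > 0 \<and> b < 0"
  defines "l \<equiv> (\<bar>b\<bar> - \<bar>a\<bar>) / (\<bar>b\<bar> + \<bar>a\<bar>)"
  shows "((1 - l) / 2) *\<^sub>R q + ((1 + l) / 2) *\<^sub>R p = (a *\<^sub>R q - b *\<^sub>R p) /\<^sub>R (a - b)"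
proof -
  have "l = (a + b) / (b - a)"
  proof (cases "a < 0")
    case True
    then show ?thesis using assms(1) by (simp add: l_def)
  next
    case False
    then have "l = - (a + b) / - (b - a)" using assms(1) by (simp add: l_def)
    then show ?thesis using minus_divide_divide[of "a + b" "b - a"] by argo
  qed
  moreover have "a - b \<noteq> 0" "b - a \<noteq> 0" using assms(1) by auto
  ultimately have weights: "(1 - l) / 2 = inverse (a - b) * a" "(1 + l) / 2 = - (inverse (a - b) * b)"
    by (simp_all add: field_simps)
  show ?thesis
    unfolding weights by (simp add: scaleR_diff_right)
qed

theorem lemma3p1:
  fixes \<Omega> S :: "(real^'n) set"
    and H V :: "real^'n \<Rightarrow> real"
    and fL fR :: "real^'n \<Rightarrow> real^'n"
    and \<eta> :: "real^'n \<Rightarrow> real^2"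
    and k :: nat
    and x :: "real^'n"
  assumes "k \<ge> 1"
    and "piecewise_C_k k \<Omega> H fL fR"
    and "refracting \<Omega> H fL fR"
    and "V = lie_derivative fL 1 H"
    and "\<eta> = (\<lambda>y. vector [H y, V y])"
    and "visible_visible_region \<Omega> H fL fR S \<or> invisible_invisible_region \<Omega> H fL fR S"
    and "x \<in> S"
  shows "tangential_sliding \<eta> fL fR x = second_order_sliding H fL fR x"
proof -
  \<comment> \<open>Writing \<open>k\<close> as a successor exposes two orders of differentiability
    of \<open>H\<close> and one of the fields, as needed to differentiate the first Lie
    derivatives.\<close>
  from assms(1) obtain j where k: "k = Suc j" by (cases k) auto
  have open_\<Omega>: "open \<Omega>" and fL: "C_k_on (Suc j) fL \<Omega>" and fR: "C_k_on (Suc j) fR \<Omega>"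
    and H: "C_k_on (Suc (Suc j)) H \<Omega>"
    and grad: "\<And>y. y \<in> \<Omega> \<Longrightarrow> H y = 0 \<Longrightarrow> gradient H y \<noteq> 0"
    using assms(2) unfolding piecewise_C_k_def k switching_surface_def by (auto simp del: C_k_on.simps)
  define W where "W = lie_derivative fR 1 H"
  have VW: "V y = W y" if "y \<in> \<Omega>" "H y = 0" for y
    using assms(3,4) that by (auto simp: refracting_def switching_surface_def W_def)
  have x: "x \<in> \<Omega>" "H x = 0" "V x = 0"
    using assms(4,6,7)
    by (auto simp: visible_visible_region_def invisible_invisible_region_def
        tangency_surface_def switching_surface_def)
  define a where "a = lie_derivative fL 2 H x"
  define b where "b = lie_derivative fR 2 H x"
  have sgn: "a < 0 \<and> b > 0 \<or> a > 0 \<and> b < 0"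
    using assms(6,7)
    by (auto simp: visible_visible_region_def invisible_invisible_region_def a_def b_def)
  have dH: "H differentiable (at x)" using H x by simp
  have d: "fL differentiable (at x)" "fR differentiable (at x)" using fL fR x by simp_all
  have dV: "V differentiable (at x)" and dW: "W differentiable (at x)"
    unfolding assms(4) W_def using lie_derivative_1_differentiable[OF open_\<Omega> x(1) H] d by blast+
  define H' V' W' where "H' = frechet_derivative H (at x)"
    and "V' = frechet_derivative V (at x)" and "W' = frechet_derivative W (at x)"
  have derH: "(H has_derivative H') (at x)" and derV: "(V has_derivative V') (at x)"
    and derW: "(W has_derivative W') (at x)"
    using dH dV dW by (simp_all add: H'_def V'_def W'_def frechet_derivative_works)
  have H'L: "H' (fL x) = 0"
    using gradient_inner[OF dH, of "fL x"] x(3) by (simp add: H'_def assms(4))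
  \<comment> \<open>The refracting condition enters: \<open>H' (fR x)\<close> is \<open>W x\<close>,
    which equals \<open>V x = 0\<close>.\<close>
  have H'R: "H' (fR x) = 0"
    using gradient_inner[OF dH, of "fR x"] x VW[OF x(1,2)] by (simp add: H'_def W_def)
  have V'L: "V' (fL x) = a"
    using lie_derivative_Suc_eq_frechet[of fL 1 H x] dV
    by (simp add: V'_def a_def assms(4) numeral_2_eq_2 del: lie_derivative.simps)
  have W'R: "W' (fR x) = b"
    using lie_derivative_Suc_eq_frechet[of fR 1 H x] dW
    by (simp add: W'_def b_def W_def numeral_2_eq_2 del: lie_derivative.simps)
  \<comment> \<open>The gradient is the transversal direction: \<open>H'\<close> sends it to its
    squared norm.\<close>
  have "H' (gradient H x) \<noteq> 0"
    using gradient_inner[OF dH, of "gradient H x"] grad[OF x(1,2)]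
    by (metis H'_def inner_eq_zero_iff)
  \<comment> \<open>The tangent-direction lemma is applied to \<open>g = V - W\<close>, which
    vanishes on the switching surface, with \<open>v = fR x\<close>.\<close>
  then have "V' (fR x) - W' (fR x) = 0"
    using VW
    by (intro derivative_tangent_eq_0[OF open_\<Omega> x(1) C_k_on_imp_continuous_on[OF H] derH x(2) H'R _
          has_derivative_diff[OF derV derW]]) auto
  then have V'R: "V' (fR x) = b" using W'R by simp
  have "sliding_weight \<eta> fL fR x = (\<bar>b\<bar> - \<bar>a\<bar>) / (\<bar>b\<bar> + \<bar>a\<bar>)"
    unfolding sliding_weight_def assms(5) jacobian_vector_2[OF derH derV] H'L H'R V'L V'R
      norm_vector_2 ..
  then show ?thesis
    unfolding tangential_sliding_def second_order_sliding_def
    using sliding_combination_eq[OF sgn, of "fR x" "fL x"] by (simp add: a_def b_def)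
qed

end
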